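(* Let $n\ge0$ be an arbitrary integer and let $\Gamma$ be the Gram matrix of the Bernstein system $\mathscr{B}_n$, with eigenvalues $\lambda_0\ge\lambda_1\ge\cdots\ge\lambda_n>0$. Then for all $0\le k\le n$, we have $\Gamma\varphi_k=\lambda_k\varphi_k$, where $\varphi_k$ is the degree $k$ discrete Legendre polynomial on $\{0,\dots,n\}$, and $$\lambda_k=\frac{(n)_k}{(n+k+1)_{k+1}}.$$
   Context: For $0\le k\le n$, $p_{n,k}(x):=\binom{n}{k}x^k(1-x)^{n-k}$ and $\mathscr{B}_n:=(p_{n,k})_{k=0}^n$. Its Gram matrix $\Gamma=\Gamma_n\in\mathbb{R}^{(n+1)\times(n+1)}$ has entries $\Gamma_{k,\ell}:=\int_0^1p_{n,k}(x)p_{n,\ell}(x)\,dx$, $k,\ell=0,\dots,n$; it is positive-definite. Vectors in $\mathbb{R}^{n+1}$ are identified with functions on $\{0,\dots,n\}$, with the standard Euclidean inner product. The discrete Legendre polynomials $\varphi_0,\dots,\varphi_n$ on $\{0,\dots,n\}$ are determined, up to sign, by the requirements that $\varphi_k(\ell)$ is a polynomial in $\ell\in\{0,\dots,n\}$ of degree exactly $k$ and $\sum_{\ell=0}^n\varphi_k(\ell)\varphi_j(\ell)=\delta_{k,j}$. The falling factorial is $(t)_k:=t(t-1)\cdots(t-k+1)$, $(t)_0:=1$. *)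

theory Defs
  imports
    "HOL-Analysis.Analysis"
    "Jordan_Normal_Form.Char_Poly"
begin

definition bernstein_gram :: "nat \<Rightarrow> real mat" where
  "bernstein_gram n =
     Matrix.mat (n + 1) (n + 1)
       (\<lambda>(k, l). integral {0..1} (\<lambda>x. Bernstein n k x * Bernstein n l x))"

text \<open>
  The real eigenvalues of a real square matrix, in decreasing order and repeated according to
  algebraic multiplicity. The length of the list equals the dimension of the matrix precisely when
  the characteristic polynomial splits over the reals, as it does for symmetric matrices.
\<close>

definition eigenvalues_desc :: "real mat \<Rightarrow> real list" where
  "eigenvalues_desc A = rev (sorted_list_of_multiset (proots (char_poly A)))"

definition falling_factorial :: "'a::comm_ring_1 \<Rightarrow> nat \<Rightarrow> 'a" where
  "falling_factorial t k = (\<Prod>i<k. t - of_nat i)"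

text \<open>
  Only the values \<open>phi k l\<close> with \<open>k, l \<le> n\<close> are constrained. The signs of the \<open>phi k\<close> are left
  open, so this is a predicate rather than a choice of one particular family. The polynomial is an
  element of \<open>real poly\<close>, so that its degree is meaningful; as \<open>k \<le> n\<close>, it is the
  unique interpolating polynomial of degree at most \<open>n\<close>.
\<close>

definition discrete_legendre :: "nat \<Rightarrow> (nat \<Rightarrow> nat \<Rightarrow> real) \<Rightarrow> bool" where
  "discrete_legendre n phi \<longleftrightarrow>
     (\<forall>k\<le>n. \<exists>p :: real poly. Polynomial.degree p = k \<and> (\<forall>l\<le>n. phi k l = poly p (real l))) \<and>
     (\<forall>k\<le>n. \<forall>j\<le>n. (\<Sum>l\<le>n. phi k l * phi j l) = (if k = j then 1 else 0))"

definition vec_of_fun :: "nat \<Rightarrow> (nat \<Rightarrow> real) \<Rightarrow> real Matrix.vec" where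
  "vec_of_fun n f = Matrix.vec (n + 1) f"

text \<open>Gram--Schmidt orthonormalisation of the monomials on \<open>{0..n}\<close>.\<close>

lemma discrete_legendre_exists: "\<exists>phi. discrete_legendre n phi"
proof -
  define ip :: "real poly \<Rightarrow> real poly \<Rightarrow> real" where
    "ip p q = (\<Sum>l\<le>n. poly p (real l) * poly q (real l))" for p q
  have ip_comm: "ip p q = ip q p" for p q
    by (simp add: ip_def mult.commute)
  have ip_diff: "ip (p - q) r = ip p r - ip q r" for p q r
    by (simp add: ip_def algebra_simps sum_subtractf)
  have ip_smult: "ip (Polynomial.smult c p) r = c * ip p r" for c p r
    by (simp add: ip_def sum_distrib_left mult.assoc)
  have ip_sum: "ip (\<Sum>i\<in>A. f i) r = (\<Sum>i\<in>A. ip (f i) r)" if "finite A"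
    for A :: "nat set" and f r
    unfolding ip_def by (simp add: poly_sum sum_distrib_right sum.swap[of _ "{..n}"])
  have ip_pos: "ip p p > 0" if "p \<noteq> 0" "Polynomial.degree p \<le> n" for p
  proof (rule ccontr)
    assume "\<not> ip p p > 0"
    moreover have "ip p p \<ge> 0" by (simp add: ip_def sum_nonneg)
    ultimately have "ip p p = 0" by simp
    hence "\<forall>l\<le>n. poly p (real l) = 0"
      unfolding ip_def by (subst (asm) sum_nonneg_eq_0_iff) auto
    hence "real ` {..n} \<subseteq> {x. poly p x = 0}" by auto
    hence "card (real ` {..n}) \<le> card {x. poly p x = 0}"
      using poly_roots_finite[OF that(1)] by (rule card_mono[rotated])
    also have "\<dots> \<le> Polynomial.degree p" by (rule card_poly_roots_bound[OF that(1)])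
    finally show False using that(2) by (simp add: card_image)
  qed
  have "\<exists>q :: nat \<Rightarrow> real poly. (\<forall>k<m. Polynomial.degree (q k) = k) \<and>
      (\<forall>k<m. \<forall>j<m. ip (q k) (q j) = (if k = j then 1 else 0))" if "m \<le> n + 1" for m
    using that
  proof (induction m)
    case 0
    show ?case by simp
  next
    case (Suc m)
    then obtain q where deg: "\<And>k. k < m \<Longrightarrow> Polynomial.degree (q k) = k"
      and orth: "\<And>k j. k < m \<Longrightarrow> j < m \<Longrightarrow> ip (q k) (q j) = (if k = j then 1 else 0)"
      by auto
    define s where "s = (\<Sum>j<m. Polynomial.smult (ip (Polynomial.monom 1 m) (q j)) (q j))"
    define p where "p = Polynomial.monom 1 m - s"
    have "Polynomial.coeff s i = 0" if "i \<ge> m" for i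
      using that deg unfolding s_def coeff_sum
      by (intro sum.neutral) (auto intro!: coeff_eq_0)
    hence cm: "Polynomial.coeff p m = 1" and cz: "\<And>i. i > m \<Longrightarrow> Polynomial.coeff p i = 0"
      by (auto simp: p_def)
    have dp: "Polynomial.degree p = m"
      using cm cz by (intro antisym degree_le le_degree) auto
    have pn: "p \<noteq> 0" using cm by auto
    have pos: "ip p p > 0" using Suc.prems dp pn by (intro ip_pos) auto
    have po: "ip p (q j) = 0" if "j < m" for j
    proof -
      have "ip s (q j) = (\<Sum>i<m. ip (Polynomial.monom 1 m) (q i) * (if i = j then 1 else 0))"
        unfolding s_def using that by (simp add: ip_sum ip_smult orth)
      also have "\<dots> = ip (Polynomial.monom 1 m) (q j)" using that by (simp add: if_distrib[of "\<lambda>x. _ * x"] cong: if_cong)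
      finally show ?thesis by (simp add: p_def ip_diff)
    qed
    define r where "r = Polynomial.smult (1 / sqrt (ip p p)) p"
    have "Polynomial.degree r = m" using dp pos by (simp add: r_def)
    moreover have "ip r r = 1"
      using pos by (simp add: r_def ip_smult ip_comm[of p "Polynomial.smult _ p"])
    moreover have "ip r (q j) = 0" "ip (q j) r = 0" if "j < m" for j
      using po[OF that] by (simp_all add: r_def ip_smult ip_comm[of "q j"])
    ultimately show ?case
      using deg orth by (intro exI[of _ "q(m := r)"]) (auto simp: less_Suc_eq)
  qed
  from this[of "n + 1"] obtain q :: "nat \<Rightarrow> real poly" where
    "\<And>k. k \<le> n \<Longrightarrow> Polynomial.degree (q k) = k"
    "\<And>k j. k \<le> n \<Longrightarrow> j \<le> n \<Longrightarrow> ip (q k) (q j) = (if k = j then 1 else 0)"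
    by (auto simp: less_Suc_eq_le)
  hence "discrete_legendre n (\<lambda>k l. poly (q k) (real l))"
    unfolding discrete_legendre_def ip_def by blast
  thus ?thesis by blast
qed

end

theory Submission
  imports Defs
begin

(* The idea: the sum of (l)_j p_{n,l}(x) over l is (n)_j x^j, and integrating this against p_{n,m}
   gives (n)_j n!/(n+j+1)! times (m+1)(m+2)...(m+j). Hence Gamma preserves the filtration of the
   functions on {0..n} by polynomial degree and acts on the j-th graded piece as multiplication by
   (n)_j / (n+j+1)_{j+1}. A symmetric operator that is triangular with respect to a filtration is
   diagonal in the orthonormal basis adapted to it, and that basis is the discrete Legendre one.
   The resulting n+1 eigenvalues are strictly decreasing, so they exhaust the spectrum. *)

section \<open>Moments of the Bernstein polynomials\<close>

lemma falling_factorial_of_nat: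
  "falling_factorial (of_nat m) j = (fact j * of_nat (m choose j) :: 'a::field_char_0)"
  by (simp add: falling_factorial_def binomial_gbinomial gbinomial_mult_fact atLeast0LessThan)

lemma falling_factorial_of_nat_fact:
  assumes "j \<le> m"
  shows "falling_factorial (of_nat m) j = (fact m / fact (m - j) :: 'a::field_char_0)"
  using assms by (simp add: falling_factorial_of_nat binomial_fact)

text \<open>These are the factorial moments of the binomial distribution. Since
  \<open>(l)_j * (n choose l) = (n)_j * ((n - j) choose (l - j))\<close>, the factor
  \<open>(n)_j * x^j\<close> comes out and the binomial expansion of
  \<open>(x + (1 - x))^(n - j)\<close> remains.\<close>

lemma sum_falling_factorial_Bernstein:
  assumes "j \<le> n"
  shows "(\<Sum>l\<le>n. falling_factorial (real l) j * Bernstein n l x) = falling_factorial (real n) j * x ^ j"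
proof -
  have "(\<Sum>l\<le>n. falling_factorial (real l) j * Bernstein n l x)
      = (\<Sum>l=j..n. falling_factorial (real l) j * Bernstein n l x)"
    \<comment> \<open>Terms with \<open>l < j\<close> vanish because \<open>l choose j = 0\<close>;
      afterwards \<open>l - j\<close> is a genuine, untruncated difference.\<close>
    by (rule sum.mono_neutral_right) (auto simp: falling_factorial_of_nat)
  also have "\<dots> = (\<Sum>l=j..n. falling_factorial (real n) j * x ^ j
                    * (real ((n - j) choose (l - j)) * x ^ (l - j) * (1 - x) ^ (n - l)))"
  proof (rule sum.cong)
    fix l assume l: "l \<in> {j..n}"
    hence "(n choose l) * (l choose j) = (n choose j) * ((n - j) choose (l - j))"
      by (intro choose_mult) auto
    hence "real (l choose j) * real (n choose l) = real (n choose j) * real ((n - j) choose (l - j))"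
      by (metis of_nat_mult mult.commute)
    moreover have "x ^ l = x ^ j * x ^ (l - j)"
      using l by (simp flip: power_add)
    ultimately show "falling_factorial (real l) j * Bernstein n l x = falling_factorial (real n) j * x ^ j
                    * (real ((n - j) choose (l - j)) * x ^ (l - j) * (1 - x) ^ (n - l))"
      by (simp add: Bernstein_def falling_factorial_of_nat)
  qed simp
  also have "\<dots> = falling_factorial (real n) j * x ^ j
                    * (\<Sum>l=j..n. real ((n - j) choose (l - j)) * x ^ (l - j) * (1 - x) ^ (n - l))"
    by (simp add: sum_distrib_left)
  also have "(\<Sum>l=j..n. real ((n - j) choose (l - j)) * x ^ (l - j) * (1 - x) ^ (n - l))
      = (\<Sum>i\<le>n - j. real ((n - j) choose i) * x ^ i * (1 - x) ^ (n - j - i))"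
    by (rule sum.reindex_bij_witness[of _ "\<lambda>i. i + j" "\<lambda>l. l - j"]) (use assms in auto)
  also have "\<dots> = (x + (1 - x)) ^ (n - j)"
    by (rule binomial_ring[symmetric])
  finally show ?thesis by simp
qed

lemma has_integral_power_mult_power:
  "((\<lambda>x::real. x ^ a * (1 - x) ^ b) has_integral (fact a * fact b / fact (a + b + 1))) {0..1}"
proof -
  have "((\<lambda>x::real. x powr (real (a + 1) - 1) * (1 - x) powr (real (b + 1) - 1)) has_integral
          Beta (real (a + 1)) (real (b + 1))) {0..1}"
    by (rule has_integral_Beta_real) auto
  moreover have "Beta (real (a + 1)) (real (b + 1)) = fact a * fact b / fact (a + b + 1)"
    using Gamma_fact[of a, where 'a = real] Gamma_fact[of b, where 'a = real]
      Gamma_fact[of "a + b + 1", where 'a = real]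
    by (simp add: Beta_def add_ac)
  ultimately have "((\<lambda>x::real. x powr (real (a + 1) - 1) * (1 - x) powr (real (b + 1) - 1)) has_integral
          fact a * fact b / fact (a + b + 1)) {0..1}" by simp
  \<comment> \<open>The endpoints must be excluded: \<open>0 powr 0 = 0\<close> but
    \<open>0 ^ 0 = 1\<close>, so the two integrands may differ there.\<close>
  thus ?thesis
  proof (rule has_integral_spike_finite[of "{0, 1}", rotated 2])
    fix x :: real assume "x \<in> {0..1} - {0, 1}"
    thus "x ^ a * (1 - x) ^ b = x powr (real (a + 1) - 1) * (1 - x) powr (real (b + 1) - 1)"
      by (simp add: powr_realpow)
  qed simp
qed

text \<open>A Beta integral. The quotient \<open>(m + j)! / m!\<close> is a polynomial in
  \<open>m\<close> of degree \<open>j\<close>, which is why the Gram matrix does not raise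
  degrees.\<close>

lemma integral_Bernstein_mult_power:
  assumes "m \<le> n"
  shows "integral {0..1} (\<lambda>x. Bernstein n m x * x ^ j)
    = fact n / fact (n + j + 1) * pochhammer (real m + 1) j"
proof -
  have "((\<lambda>x. real (n choose m) * (x ^ (m + j) * (1 - x) ^ (n - m))) has_integral
      real (n choose m) * (fact (m + j) * fact (n - m) / fact (m + j + (n - m) + 1))) {0..1}"
    by (intro has_integral_mult_right has_integral_power_mult_power)
  hence "integral {0..1} (\<lambda>x. real (n choose m) * (x ^ (m + j) * (1 - x) ^ (n - m)))
      = real (n choose m) * (fact (m + j) * fact (n - m) / fact (m + j + (n - m) + 1))"
    by (rule integral_unique)
  also have "(\<lambda>x. real (n choose m) * (x ^ (m + j) * (1 - x) ^ (n - m)))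
      = (\<lambda>x. Bernstein n m x * x ^ j)"
    by (simp add: Bernstein_def power_add mult_ac)
  also have "m + j + (n - m) + 1 = n + j + 1" using assms by simp
  also have "(fact (m + j) :: real) = fact m * pochhammer (real m + 1) j"
    using pochhammer_product'[of "1 :: real" m j] by (simp add: pochhammer_fact add_ac)
  also have "real (n choose m) = fact n / (fact m * fact (n - m))"
    using assms by (rule binomial_fact)
  finally show ?thesis by simp
qed

section \<open>The Gram matrix acting on polynomials\<close>

text \<open>Entry \<open>m\<close> of the Gram matrix times the vector of samples of
  \<open>p\<close>. The argument is a polynomial so that its degree can be tracked.\<close>

definition gram_apply :: "nat \<Rightarrow> real poly \<Rightarrow> nat \<Rightarrow> real" where
  "gram_apply n p m =
     (\<Sum>l\<le>n. integral {0..1} (\<lambda>x. Bernstein n m x * Bernstein n l x) * poly p (real l))"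

definition gram_eigenvalue :: "nat \<Rightarrow> nat \<Rightarrow> real" where
  "gram_eigenvalue n k = falling_factorial (real n) k / falling_factorial (real (n + k + 1)) (k + 1)"

text \<open>The degree filtration. Bounding coefficients instead of the degree makes level 0 the
  zero space, although the zero polynomial has degree 0 by convention.\<close>

definition polys_below :: "nat \<Rightarrow> real poly set" where
  "polys_below k = {p. \<forall>i\<ge>k. Polynomial.coeff p i = 0}"

lemma polys_below_0: "p \<in> polys_below 0 \<longleftrightarrow> p = 0"
  by (auto simp: polys_below_def poly_eq_iff)

lemma polys_below_Suc: "p \<in> polys_below (Suc k) \<longleftrightarrow> Polynomial.degree p \<le> k"
  unfolding polys_below_def by (auto simp: Suc_le_eq intro: degree_le coeff_eq_0)

lemma polys_below_mono: "i \<le> j \<Longrightarrow> polys_below i \<subseteq> polys_below j"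
  by (auto simp: polys_below_def)

lemma polys_below_add: "p \<in> polys_below k \<Longrightarrow> q \<in> polys_below k \<Longrightarrow> p + q \<in> polys_below k"
  by (simp add: polys_below_def)

lemma polys_below_smult: "p \<in> polys_below k \<Longrightarrow> Polynomial.smult c p \<in> polys_below k"
  by (simp add: polys_below_def)

lemma polys_below_cancel_lead_coeff:
  assumes "p \<in> polys_below (Suc k)" "q \<in> polys_below (Suc k)"
    "Polynomial.coeff p k = c * Polynomial.coeff q k"
  shows "p - Polynomial.smult c q \<in> polys_below k"
proof -
  have "Polynomial.coeff (p - Polynomial.smult c q) i = 0" if "i \<ge> k" for i
    using assms that unfolding polys_below_def by (cases "i = k") (auto simp: Suc_le_eq)
  thus ?thesis by (simp add: polys_below_def)
qed

lemma monic_prod_linear: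
  "(\<Prod>i<k. [:a i, 1:]) \<in> polys_below (Suc k)"
  "Polynomial.coeff (\<Prod>i<k. [:a i, 1:]) k = 1"
proof -
  have deg: "Polynomial.degree (\<Prod>i<k. [:a i, 1:]) = k"
    by (subst degree_prod_sum_eq) auto
  thus "(\<Prod>i<k. [:a i, 1:]) \<in> polys_below (Suc k)" by (simp add: polys_below_Suc)
  have "lead_coeff (\<Prod>i<k. [:a i, 1:]) = 1" by (simp add: lead_coeff_prod)
  with deg show "Polynomial.coeff (\<Prod>i<k. [:a i, 1:]) k = 1" by simp
qed

lemma gram_apply_add: "gram_apply n (p + q) m = gram_apply n p m + gram_apply n q m"
  by (simp add: gram_apply_def algebra_simps sum.distrib)

lemma gram_apply_smult: "gram_apply n (Polynomial.smult c p) m = c * gram_apply n p m"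
  by (simp add: gram_apply_def sum_distrib_left mult_ac)

text \<open>Self-adjointness, from the symmetry of the integrand in its two indices. It later turns
  triangularity into diagonality.\<close>

lemma gram_apply_sym:
  "(\<Sum>m\<le>n. gram_apply n p m * poly q (real m)) = (\<Sum>m\<le>n. poly p (real m) * gram_apply n q m)"
  unfolding gram_apply_def sum_distrib_left sum_distrib_right
  by (subst sum.swap) (simp add: mult_ac)

text \<open>Uses \<open>(n+k+1)_(k+1) = (n+k+1)! / n!\<close> to reach the shape that the Beta
  integral produces.\<close>

lemma gram_eigenvalue_fact:
  assumes "k \<le> n"
  shows "gram_eigenvalue n k = falling_factorial (real n) k * fact n / fact (n + k + 1)"
  unfolding gram_eigenvalue_def by (subst (2) falling_factorial_of_nat_fact) auto

text \<open>The falling factorial is the input that the moment formula handles in closed form. Input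
  and output products are both monic of degree \<open>j\<close>, so the scalar is the diagonal entry
  with respect to the filtration.\<close>

lemma gram_apply_falling_factorial:
  assumes "j \<le> n" "m \<le> n"
  shows "gram_apply n (\<Prod>i<j. [:- real i, 1:]) m
    = gram_eigenvalue n j * poly (\<Prod>i<j. [:1 + real i, 1:]) (real m)"
proof -
  have cont: "continuous_on {0..1} (\<lambda>x. Bernstein n k x)" for k
    unfolding Bernstein_def by (intro continuous_intros)
  have "gram_apply n (\<Prod>i<j. [:- real i, 1:]) m
      = (\<Sum>l\<le>n. integral {0..1} (\<lambda>x. Bernstein n m x * Bernstein n l x) * falling_factorial (real l) j)"
    by (simp add: gram_apply_def falling_factorial_def poly_prod)
  also have "\<dots> = integral {0..1}
      (\<lambda>x. \<Sum>l\<le>n. Bernstein n m x * Bernstein n l x * falling_factorial (real l) j)"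
    by (subst integral_sum)
      (auto intro!: integrable_continuous_interval continuous_intros cont)
  also have "\<dots> = integral {0..1} (\<lambda>x. falling_factorial (real n) j * (Bernstein n m x * x ^ j))"
  proof (rule integral_cong)
    fix x :: real
    have "(\<Sum>l\<le>n. Bernstein n m x * Bernstein n l x * falling_factorial (real l) j)
        = Bernstein n m x * (\<Sum>l\<le>n. falling_factorial (real l) j * Bernstein n l x)"
      by (simp add: sum_distrib_left mult_ac)
    thus "(\<Sum>l\<le>n. Bernstein n m x * Bernstein n l x * falling_factorial (real l) j)
        = falling_factorial (real n) j * (Bernstein n m x * x ^ j)"
      by (simp add: sum_falling_factorial_Bernstein[OF assms(1)])
  qed
  also have "\<dots> = falling_factorial (real n) j * (fact n / fact (n + j + 1) * pochhammer (real m + 1) j)"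
    by (simp add: integral_Bernstein_mult_power[OF assms(2)])
  also have "\<dots> = gram_eigenvalue n j * pochhammer (real m + 1) j"
    using assms by (simp add: gram_eigenvalue_fact)
  also have "pochhammer (real m + 1) j = poly (\<Prod>i<j. [:1 + real i, 1:]) (real m)"
    by (simp add: pochhammer_prod poly_prod atLeast0LessThan add_ac)
  finally show ?thesis .
qed

text \<open>Split \<open>p = c F + r\<close> with \<open>F\<close> the falling factorial. The image
  of \<open>F\<close> is the eigenvalue times the monic \<open>R\<close>, and \<open>c R\<close>
  agrees with \<open>p\<close> up to lower degree; the image of \<open>r\<close> stays in lower
  degree by induction.\<close>

lemma gram_apply_triangular:
  assumes "k \<le> n" "p \<in> polys_below (Suc k)"
  shows "\<exists>q\<in>polys_below k. \<forall>m\<le>n. gram_apply n p m = gram_eigenvalue n k * poly p (real m) + poly q (real m)"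
  using assms
proof (induction k arbitrary: p rule: less_induct)
  case (less k p)
  define c where "c = Polynomial.coeff p k"
  define F :: "real poly" where "F = (\<Prod>i<k. [:- real i, 1:])"
  define R :: "real poly" where "R = (\<Prod>i<k. [:1 + real i, 1:])"
  define r where "r = p - Polynomial.smult c F"
  have r: "r \<in> polys_below k"
    unfolding r_def F_def c_def using less.prems
    by (intro polys_below_cancel_lead_coeff monic_prod_linear) (simp_all add: monic_prod_linear)
  have "\<exists>s\<in>polys_below k. \<forall>m\<le>n. gram_apply n r m = poly s (real m)"
  proof (cases k)
    case 0
    with r show ?thesis by (auto simp: polys_below_0 gram_apply_def)
  next
    case (Suc i)
    with less.IH[of i r] less.prems r obtain q where q: "q \<in> polys_below i"
      "\<And>m. m \<le> n \<Longrightarrow> gram_apply n r m = gram_eigenvalue n i * poly r (real m) + poly q (real m)"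
      by auto
    \<comment> \<open>At the previous level only invariance matters, so the diagonal term is
      absorbed into the lower-order polynomial.\<close>
    have "Polynomial.smult (gram_eigenvalue n i) r + q \<in> polys_below k"
      using r q(1) polys_below_mono[of i k] Suc by (intro polys_below_add polys_below_smult) auto
    with q(2) show ?thesis by (intro bexI) auto
  qed
  then obtain s where s: "s \<in> polys_below k"
    "\<And>m. m \<le> n \<Longrightarrow> gram_apply n r m = poly s (real m)" by blast
  have "p - Polynomial.smult c R \<in> polys_below k"
    unfolding R_def c_def using less.prems
    by (intro polys_below_cancel_lead_coeff monic_prod_linear) (simp_all add: monic_prod_linear)
  \<comment> \<open>The first summand corrects for replacing \<open>c R\<close> by \<open>p\<close>
    in the leading term; \<open>s\<close> is the image of \<open>r\<close>.\<close>
  hence "Polynomial.smult (- gram_eigenvalue n k) (p - Polynomial.smult c R) + s \<in> polys_below k"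
    using s(1) by (intro polys_below_add polys_below_smult)
  moreover have "gram_apply n p m = gram_eigenvalue n k * poly p (real m)
      + poly (Polynomial.smult (- gram_eigenvalue n k) (p - Polynomial.smult c R) + s) (real m)"
    if "m \<le> n" for m
  proof -
    have "gram_apply n p m = c * gram_apply n F m + gram_apply n r m"
      by (simp add: r_def flip: gram_apply_add gram_apply_smult)
    also have "gram_apply n F m = gram_eigenvalue n k * poly R (real m)"
      unfolding F_def R_def using less.prems(1) that by (rule gram_apply_falling_factorial)
    finally show ?thesis using s(2)[OF that] by (simp add: algebra_simps)
  qed
  ultimately show ?case by blast
qed

text \<open>Triangularity is applied at level \<open>k\<close> itself, with \<open>p\<close> viewed
  in the next larger space; this avoids a predecessor of \<open>k\<close>.\<close>

lemma gram_apply_polys_below: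
  assumes "k \<le> n" "p \<in> polys_below k"
  obtains q where "q \<in> polys_below k" "\<And>m. m \<le> n \<Longrightarrow> gram_apply n p m = poly q (real m)"
proof -
  obtain q where q: "q \<in> polys_below k"
    "\<And>m. m \<le> n \<Longrightarrow> gram_apply n p m = gram_eigenvalue n k * poly p (real m) + poly q (real m)"
    using gram_apply_triangular[of k n p] assms polys_below_mono[of k "Suc k"] by auto
  show ?thesis
    by (rule that[of "Polynomial.smult (gram_eigenvalue n k) p + q"])
      (use assms q in \<open>auto intro: polys_below_add polys_below_smult\<close>)
qed

section \<open>Diagonalisation in an orthonormal basis adapted to the degree\<close>

lemma orthonormal_orthogonal_polys_below:
  fixes P :: "nat \<Rightarrow> real poly"
  assumes deg: "\<And>k. k \<le> n \<Longrightarrow> Polynomial.degree (P k) = k"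
    and orth: "\<And>k j. k \<le> n \<Longrightarrow> j \<le> n \<Longrightarrow>
      (\<Sum>l\<le>n. poly (P k) (real l) * poly (P j) (real l)) = (if k = j then 1 else 0)"
    and "k \<le> n" "j \<le> k" "q \<in> polys_below j"
  shows "(\<Sum>l\<le>n. poly (P k) (real l) * poly q (real l)) = 0"
  \<comment> \<open>Leading terms of \<open>q\<close> are removed one at a time. As
    \<open>j <= k\<close>, only multiples of \<open>P i\<close> with \<open>i < k\<close> are
    subtracted, all orthogonal to \<open>P k\<close>.\<close>
  using assms(4,5)
proof (induction j arbitrary: q)
  case 0
  thus ?case by (simp add: polys_below_0)
next
  case (Suc j)
  \<comment> \<open>Nonvanishing comes from the unit norm; for \<open>j = 0\<close> the degree alone
    would not exclude the zero polynomial.\<close>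
  have "P j \<noteq> 0" using orth[of j j] Suc.prems \<open>k \<le> n\<close> by auto
  moreover have degj: "Polynomial.degree (P j) = j" using deg Suc.prems \<open>k \<le> n\<close> by simp
  ultimately have lead: "Polynomial.coeff (P j) j \<noteq> 0" by (metis leading_coeff_0_iff)
  define c where "c = Polynomial.coeff q j / Polynomial.coeff (P j) j"
  define r where "r = q - Polynomial.smult c (P j)"
  have "r \<in> polys_below j"
    unfolding r_def c_def using Suc.prems degj lead
    by (intro polys_below_cancel_lead_coeff) (simp_all add: polys_below_Suc)
  hence "(\<Sum>l\<le>n. poly (P k) (real l) * poly r (real l)) = 0"
    using Suc by simp
  moreover have "(\<Sum>l\<le>n. poly (P k) (real l) * poly (P j) (real l)) = 0"
    using orth[of k j] Suc.prems \<open>k \<le> n\<close> by simp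
  moreover have "(\<Sum>l\<le>n. poly (P k) (real l) * poly q (real l))
      = (\<Sum>l\<le>n. poly (P k) (real l) * poly r (real l))
        + c * (\<Sum>l\<le>n. poly (P k) (real l) * poly (P j) (real l))"
    by (simp add: r_def sum_distrib_left algebra_simps flip: sum.distrib)
  ultimately show ?case by simp
qed

text \<open>Let \<open>q\<close> be the lower-degree remainder from triangularity. As
  \<open>P k\<close> is orthogonal to \<open>q\<close>, the squared norm of \<open>q\<close> is the
  inner product of the image of \<open>P k\<close> with \<open>q\<close>. By symmetry this pairs
  \<open>P k\<close> with the image of \<open>q\<close>, again of lower degree, so it is
  zero.\<close>

lemma gram_apply_orthonormal:
  fixes P :: "nat \<Rightarrow> real poly"
  assumes deg: "\<And>k. k \<le> n \<Longrightarrow> Polynomial.degree (P k) = k"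
    and orth: "\<And>k j. k \<le> n \<Longrightarrow> j \<le> n \<Longrightarrow>
      (\<Sum>l\<le>n. poly (P k) (real l) * poly (P j) (real l)) = (if k = j then 1 else 0)"
    and "k \<le> n" "m \<le> n"
  shows "gram_apply n (P k) m = gram_eigenvalue n k * poly (P k) (real m)"
proof -
  have perp: "(\<Sum>l\<le>n. poly (P k) (real l) * poly q (real l)) = 0" if "q \<in> polys_below k" for q
    using deg orth \<open>k \<le> n\<close> order_refl that by (rule orthonormal_orthogonal_polys_below)
  obtain q where q: "q \<in> polys_below k"
    "\<And>m. m \<le> n \<Longrightarrow> gram_apply n (P k) m = gram_eigenvalue n k * poly (P k) (real m) + poly q (real m)"
    using gram_apply_triangular[of k n "P k"] deg \<open>k \<le> n\<close> by (auto simp: polys_below_Suc)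
  obtain s where s: "s \<in> polys_below k" "\<And>m. m \<le> n \<Longrightarrow> gram_apply n q m = poly s (real m)"
    using gram_apply_polys_below[OF \<open>k \<le> n\<close> q(1)] by blast
  have "(\<Sum>l\<le>n. poly q (real l) * poly q (real l))
      = (\<Sum>l\<le>n. gram_apply n (P k) l * poly q (real l))
        - gram_eigenvalue n k * (\<Sum>l\<le>n. poly (P k) (real l) * poly q (real l))"
    by (simp add: q(2) sum_distrib_left algebra_simps flip: sum_subtractf)
  also have "(\<Sum>l\<le>n. gram_apply n (P k) l * poly q (real l))
      = (\<Sum>l\<le>n. poly (P k) (real l) * poly s (real l))"
    by (simp add: gram_apply_sym s(2))
  also have "\<dots> = 0" by (rule perp[OF s(1)])
  also have "(\<Sum>l\<le>n. poly (P k) (real l) * poly q (real l)) = 0" by (rule perp[OF q(1)])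
  finally have "(\<Sum>l\<le>n. poly q (real l) * poly q (real l)) = 0" by simp
  hence "poly q (real m) * poly q (real m) = 0"
    using \<open>m \<le> n\<close> by (subst (asm) sum_nonneg_eq_0_iff) auto
  thus ?thesis using q(2)[OF \<open>m \<le> n\<close>] by simp
qed

section \<open>The ordered spectrum\<close>

lemma gram_eigenvalue_pos:
  assumes "k \<le> n"
  shows "gram_eigenvalue n k > 0"
  using assms by (simp add: gram_eigenvalue_fact falling_factorial_of_nat)

text \<open>Consecutive eigenvalues have ratio \<open>(n - k) / (n + k + 2)\<close>, which is below
  1.\<close>

lemma gram_eigenvalue_Suc_less:
  assumes "Suc k \<le> n"
  shows "gram_eigenvalue n (Suc k) < gram_eigenvalue n k"
proof -
  have "gram_eigenvalue n (Suc k) = gram_eigenvalue n k * ((real n - real k) / (real n + real k + 2))"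
    using assms by (simp add: gram_eigenvalue_fact falling_factorial_def divide_simps)
  also have "\<dots> < gram_eigenvalue n k * 1"
    using assms gram_eigenvalue_pos[of k n] by (intro mult_strict_left_mono) (auto simp: divide_simps)
  finally show ?thesis by simp
qed

lemma gram_eigenvalue_less:
  assumes "j < k" "k \<le> n"
  shows "gram_eigenvalue n k < gram_eigenvalue n j"
  using assms
proof (induction k)
  case (Suc k)
  thus ?case using gram_eigenvalue_Suc_less[of k n] by (cases "j = k") auto
qed simp

text \<open>A characteristic polynomial of degree \<open>d\<close> has at most \<open>d\<close>
  roots with multiplicity, so \<open>d\<close> distinct eigenvalues are all of them and each is
  simple.\<close>

lemma eigenvalues_desc_eqI:
  fixes A :: "real mat"
  assumes A: "A \<in> carrier_mat d d"
    and less: "\<And>i j. i < j \<Longrightarrow> j < d \<Longrightarrow> f j < f i"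
    and ev: "\<And>i. i < d \<Longrightarrow> eigenvalue A (f i)"
  shows "eigenvalues_desc A = map f [0..<d]"
proof -
  let ?xs = "rev (map f [0..<d])"
  have sorted: "sorted_wrt (<) ?xs"
    using less by (simp only: sorted_wrt_rev sorted_wrt_map) (simp add: sorted_wrt_iff_nth_less)
  hence "distinct ?xs" "sorted ?xs"
    unfolding strict_sorted_iff by blast+
  have deg: "Polynomial.degree (char_poly A) = d" and "char_poly A \<noteq> 0"
    using degree_monic_char_poly[OF A] by auto
  \<comment> \<open>Each value occurs once on the left and is a root, hence has order at least 1 on
    the right; comparing sizes then forces equality.\<close>
  have "mset ?xs \<subseteq># proots (char_poly A)"
  proof (rule mset_subset_eqI)
    fix x
    have "count (mset ?xs) x = (if x \<in> f ` {0..<d} then 1 else 0)"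
      using distinct_count_atmost_1[THEN iffD1, OF \<open>distinct ?xs\<close>] by simp
    moreover have "Polynomial.order x (char_poly A) \<ge> 1" if "x \<in> f ` {0..<d}"
      using that ev eigenvalue_root_char_poly[OF A] \<open>char_poly A \<noteq> 0\<close>
      by (auto simp: Suc_le_eq order_root)
    ultimately show "count (mset ?xs) x \<le> count (proots (char_poly A)) x"
      using \<open>char_poly A \<noteq> 0\<close> by simp
  qed
  moreover have "size (proots (char_poly A)) \<le> size (mset ?xs)"
    using size_proots_le[of "char_poly A"] deg by simp
  ultimately have "proots (char_poly A) = mset ?xs"
    by (metis mset_subset_size subset_mset.le_neq_trans not_less)
  hence "eigenvalues_desc A = rev (sort ?xs)"
    unfolding eigenvalues_desc_def by (simp only: sorted_list_of_multiset_mset)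
  also have "sort ?xs = ?xs" using \<open>sorted ?xs\<close> by (rule sorted_sort_id)
  finally show ?thesis by simp
qed

theorem theorem9:
  fixes n :: nat and phi :: "nat \<Rightarrow> nat \<Rightarrow> real"
  assumes "discrete_legendre n phi"
  shows "length (eigenvalues_desc (bernstein_gram n)) = n + 1 \<and>
    eigenvalues_desc (bernstein_gram n) ! n > 0 \<and>
    (\<forall>k\<le>n.
      bernstein_gram n *\<^sub>v vec_of_fun n (phi k) =
        (eigenvalues_desc (bernstein_gram n) ! k) \<cdot>\<^sub>v vec_of_fun n (phi k) \<and>
      eigenvalues_desc (bernstein_gram n) ! k =
        falling_factorial (real n) k / falling_factorial (real (n + k + 1)) (k + 1))"
proof -
  obtain P :: "nat \<Rightarrow> real poly" where deg: "\<And>k. k \<le> n \<Longrightarrow> Polynomial.degree (P k) = k"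
    and phi: "\<And>k l. k \<le> n \<Longrightarrow> l \<le> n \<Longrightarrow> phi k l = poly (P k) (real l)"
    using assms unfolding discrete_legendre_def by metis
  have norm: "(\<Sum>l\<le>n. phi k l * phi j l) = (if k = j then 1 else 0)" if "k \<le> n" "j \<le> n" for k j
    using assms that unfolding discrete_legendre_def by blast
  have orth: "(\<Sum>l\<le>n. poly (P k) (real l) * poly (P j) (real l)) = (if k = j then 1 else 0)"
    if "k \<le> n" "j \<le> n" for k j
    using norm[OF that] that by (simp add: phi)
  have carrier: "bernstein_gram n \<in> carrier_mat (n + 1) (n + 1)"
    by (simp add: bernstein_gram_def)
  have gram: "bernstein_gram n *\<^sub>v vec_of_fun n (phi k) = gram_eigenvalue n k \<cdot>\<^sub>v vec_of_fun n (phi k)"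
    if "k \<le> n" for k
  proof (rule eq_vecI)
    fix m assume "m < dim_vec (gram_eigenvalue n k \<cdot>\<^sub>v vec_of_fun n (phi k))"
    hence m: "m \<le> n" by (simp add: vec_of_fun_def)
    have "(bernstein_gram n *\<^sub>v vec_of_fun n (phi k)) $ m = gram_apply n (P k) m"
      using m that by (simp add: bernstein_gram_def vec_of_fun_def scalar_prod_def gram_apply_def phi
          atLeast0LessThan lessThan_Suc_atMost del: sum.op_ivl_Suc sum.lessThan_Suc)
    also have "\<dots> = gram_eigenvalue n k * poly (P k) (real m)"
      by (rule gram_apply_orthonormal[OF deg orth that m])
    finally show "(bernstein_gram n *\<^sub>v vec_of_fun n (phi k)) $ m
        = (gram_eigenvalue n k \<cdot>\<^sub>v vec_of_fun n (phi k)) $ m"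
      using m that by (simp add: vec_of_fun_def phi)
  qed (simp add: bernstein_gram_def vec_of_fun_def)
  have "eigenvalue (bernstein_gram n) (gram_eigenvalue n k)" if "k \<le> n" for k
  proof -
    \<comment> \<open>An eigenvector must be nonzero, which the normalisation of
      \<open>phi k\<close> guarantees.\<close>
    have "vec_of_fun n (phi k) \<noteq> 0\<^sub>v (n + 1)"
    proof
      assume "vec_of_fun n (phi k) = 0\<^sub>v (n + 1)"
      hence "vec_of_fun n (phi k) $ l = 0" if "l \<le> n" for l using that by simp
      hence "phi k l = 0" if "l \<le> n" for l using that by (simp add: vec_of_fun_def)
      with norm[OF that that] show False by simp
    qed
    thus ?thesis
      unfolding eigenvalue_def eigenvector_def using gram[OF that]
      by (intro exI[of _ "vec_of_fun n (phi k)"]) (simp add: bernstein_gram_def vec_of_fun_def)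
  qed
  hence ev: "eigenvalues_desc (bernstein_gram n) = map (gram_eigenvalue n) [0..<n + 1]"
    by (intro eigenvalues_desc_eqI[OF carrier] gram_eigenvalue_less) auto
  hence nth: "eigenvalues_desc (bernstein_gram n) ! k = gram_eigenvalue n k" if "k \<le> n" for k
    using that by (simp del: upt_Suc)
  \<comment> \<open>Indexed entries are rewritten first, while \<open>gram\<close> still matches;
    only then is the list unfolded for its length.\<close>
  show ?thesis
    using gram gram_eigenvalue_pos[of n n] by (simp add: nth) (simp add: ev gram_eigenvalue_def)
qed

end
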